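(* Let $\mathcal{P}=\{A_1,A_2,A_3,A_4,A_5\}$. Then for every integer $n\ge 1$, $$s_n(\mathcal{P})=S(n+1),$$ where $S(m)$ denotes the $m$-th secant number.
   Context: A standard piece is a $2\times 2$ matrix whose four entries are $1,2,3,4$, each occurring exactly once. For $n\ge 1$, a standard $n$-puzzle is a $2\times(n+1)$ matrix whose entries are $1,2,\dots,2n+2$, each occurring exactly once; its pieces are its $n$ submatrices formed by two consecutive columns. The reduction of a piece is the standard piece obtained by replacing its four distinct entries by $1,2,3,4$ in an order-preserving way. A set $\mathcal{P}$ of standard pieces is a support of a puzzle if the reduction of each piece of the puzzle lies in $\mathcal{P}$. $S_n(\mathcal{P})$ is the set of standard $n$-puzzles having $\mathcal{P}$ as a support, and $s_n(\mathcal{P})=|S_n(\mathcal{P})|$. The standard pieces used are $A_1=\left[\begin{smallmatrix}4&3\\1&2\end{smallmatrix}\right]$, $A_2=\left[\begin{smallmatrix}3&4\\1&2\end{smallmatrix}\right]$, $A_3=\left[\begin{smallmatrix}2&4\\1&3\end{smallmatrix}\right]$, $A_4=\left[\begin{smallmatrix}3&4\\2&1\end{smallmatrix}\right]$, $A_5=\left[\begin{smallmatrix}4&3\\2&1\end{smallmatrix}\right]$. The secant numbers (OEIS A000364) are defined by $\sec x=\sum_{m\ge 0}S(m)\frac{x^{2m}}{(2m)!}$, so $S(0)=1,S(1)=1,S(2)=5,S(3)=61,\dots$. *)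

theory Defs
  imports
    "Jordan_Normal_Form.Matrix"
    "HOL-Computational_Algebra.Formal_Power_Series"
    "HOL-Analysis.FPS_Convergence"
begin

unbundle no vec_syntax

section \<open>Puzzles and their pieces\<close>

text \<open>
  Rows and columns of matrices are numbered from \<open>0\<close>; row \<open>0\<close> is the top row.
\<close>

definition standard_piece :: "nat mat \<Rightarrow> bool" where
  "standard_piece p \<longleftrightarrow>
     p \<in> carrier_mat 2 2 \<and> bij_betw (\<lambda>ij. p $$ ij) ({0..<2} \<times> {0..<2}) {1..4}"

definition standard_puzzle :: "nat \<Rightarrow> nat mat \<Rightarrow> bool" where
  "standard_puzzle n M \<longleftrightarrow>
     M \<in> carrier_mat 2 (n + 1) \<and>
     bij_betw (\<lambda>ij. M $$ ij) ({0..<2} \<times> {0..<n + 1}) {1..2 * n + 2}"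

definition piece :: "nat mat \<Rightarrow> nat \<Rightarrow> nat mat" where
  "piece M j = Matrix.mat 2 2 (\<lambda>(i, k). M $$ (i, j + k))"

text \<open>
  Each entry is replaced by its rank among the four entries. For distinct entries this is the
  only order-preserving way to obtain a standard piece, see \<open>standard_piece_reduction\<close>,
  \<open>reduction_less_iff\<close> and \<open>reduction_unique\<close> below.
\<close>

definition reduction :: "nat mat \<Rightarrow> nat mat" where
  "reduction p =
     Matrix.mat 2 2 (\<lambda>ij. card {kl \<in> {0..<2} \<times> {0..<2}. p $$ kl \<le> p $$ ij})"

definition is_support :: "nat mat set \<Rightarrow> nat \<Rightarrow> nat mat \<Rightarrow> bool" where
  "is_support P n M \<longleftrightarrow> (\<forall>j<n. reduction (piece M j) \<in> P)"

definition puzzles :: "nat \<Rightarrow> nat mat set \<Rightarrow> nat mat set" where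
  "puzzles n P = {M. standard_puzzle n M \<and> is_support P n M}"

definition num_puzzles :: "nat \<Rightarrow> nat mat set \<Rightarrow> nat" where
  "num_puzzles n P = card (puzzles n P)"

definition A1 :: "nat mat" where "A1 = mat_of_rows_list 2 [[4, 3], [1, 2]]"
definition A2 :: "nat mat" where "A2 = mat_of_rows_list 2 [[3, 4], [1, 2]]"
definition A3 :: "nat mat" where "A3 = mat_of_rows_list 2 [[2, 4], [1, 3]]"
definition A4 :: "nat mat" where "A4 = mat_of_rows_list 2 [[3, 4], [2, 1]]"
definition A5 :: "nat mat" where "A5 = mat_of_rows_list 2 [[4, 3], [2, 1]]"

lemma finite_puzzles: "finite (puzzles n P)"
proof -
  let ?I = "{0..<2::nat} \<times> {0..<n + 1}"
  have "inj_on (\<lambda>M. restrict (\<lambda>ij. M $$ ij) ?I) (puzzles n P)"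
  proof (rule inj_onI)
    fix M N
    assume M: "M \<in> puzzles n P" and N: "N \<in> puzzles n P"
      and eq: "restrict (\<lambda>ij. M $$ ij) ?I = restrict (\<lambda>ij. N $$ ij) ?I"
    have "M $$ ij = N $$ ij" if "ij \<in> ?I" for ij
      using fun_cong[OF eq, of ij] that by simp
    then show "M = N"
      using M N by (intro eq_matI) (auto simp: puzzles_def standard_puzzle_def)
  qed
  moreover have "(\<lambda>M. restrict (\<lambda>ij. M $$ ij) ?I) ` puzzles n P \<subseteq> ?I \<rightarrow>\<^sub>E {1..2 * n + 2}"
    unfolding puzzles_def standard_puzzle_def bij_betw_def restrict_PiE_iff image_subset_iff
    by blast
  moreover have "finite (?I \<rightarrow>\<^sub>E {1..2 * n + 2})"
    by (intro finite_PiE) auto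
  ultimately show ?thesis
    by (meson finite_imageD finite_subset)
qed

lemma reduction_less_iff:
  assumes "ij \<in> {0..<2} \<times> {0..<2}" "kl \<in> {0..<2} \<times> {0..<2}"
  shows "reduction p $$ ij < reduction p $$ kl \<longleftrightarrow> p $$ ij < p $$ kl"
proof -
  let ?I = "{0..<2::nat} \<times> {0..<2::nat}"
  let ?R = "\<lambda>x. {kl \<in> ?I. p $$ kl \<le> p $$ x}"
  have r: "reduction p $$ x = card (?R x)" if "x \<in> ?I" for x
    using that by (cases x) (auto simp: reduction_def)
  have fin: "finite (?R x)" for x
    by (rule finite_subset[of _ ?I]) auto
  show ?thesis
  proof
    assume "p $$ ij < p $$ kl"
    then have "?R ij \<subseteq> ?R kl" "kl \<in> ?R kl" "kl \<notin> ?R ij"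
      using assms by auto
    then have "?R ij \<subset> ?R kl" by blast
    then show "reduction p $$ ij < reduction p $$ kl"
      using psubset_card_mono[OF fin] by (simp only: r[OF assms(1)] r[OF assms(2)])
  next
    assume *: "reduction p $$ ij < reduction p $$ kl"
    show "p $$ ij < p $$ kl"
    proof (rule ccontr)
      assume "\<not> p $$ ij < p $$ kl"
      then have "?R kl \<subseteq> ?R ij" by auto
      then have "card (?R kl) \<le> card (?R ij)" using fin card_mono by blast
      then show False using * r assms by simp
    qed
  qed
qed

lemma standard_piece_reduction:
  assumes "inj_on (\<lambda>ij. p $$ ij) ({0..<2} \<times> {0..<2})"
  shows "standard_piece (reduction p)"
proof -
  let ?I = "{0..<2::nat} \<times> {0..<2::nat}"
  let ?f = "\<lambda>ij. reduction p $$ ij"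
  have inj: "inj_on ?f ?I"
    using reduction_less_iff[of _ _ p] assms unfolding inj_on_def
    by (metis less_irrefl_nat linorder_neq_iff)
  have "?f ij \<in> {1..4}" if ij: "ij \<in> ?I" for ij
  proof -
    let ?R = "{kl \<in> ?I. p $$ kl \<le> p $$ ij}"
    have "?f ij = card ?R" using ij by (cases ij) (auto simp: reduction_def)
    moreover have "card ?R \<le> card ?I" by (intro card_mono) auto
    moreover have "finite ?R" "ij \<in> ?R"
      using ij by (auto intro: finite_subset[of _ ?I])
    then have "card ?R > 0" by (subst card_gt_0_iff) blast
    ultimately show ?thesis by simp
  qed
  then have "?f ` ?I \<subseteq> {1..4}" by blast
  moreover have "card (?f ` ?I) = card {1..4::nat}"
    using card_image[OF inj] by simp
  ultimately have "?f ` ?I = {1..4}" by (intro card_subset_eq) auto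
  with inj show ?thesis
    by (simp add: standard_piece_def bij_betw_def reduction_def)
qed

lemma reduction_unique:
  assumes q: "standard_piece q"
    and mono: "\<And>ij kl. ij \<in> {0..<2} \<times> {0..<2} \<Longrightarrow> kl \<in> {0..<2} \<times> {0..<2} \<Longrightarrow>
      q $$ ij < q $$ kl \<longleftrightarrow> p $$ ij < p $$ kl"
  shows "q = reduction p"
proof (rule eq_matI)
  let ?I = "{0..<2::nat} \<times> {0..<2::nat}"
  have bij: "bij_betw (\<lambda>ij. q $$ ij) ?I {1..4}" and dim: "q \<in> carrier_mat 2 2"
    using q by (auto simp: standard_piece_def)
  show "dim_row q = dim_row (reduction p)" "dim_col q = dim_col (reduction p)"
    using dim by (auto simp: reduction_def)
  fix i j assume "i < dim_row (reduction p)" "j < dim_col (reduction p)"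
  then have ij: "(i, j) \<in> ?I" by (auto simp: reduction_def)
  then have le: "q $$ (i, j) \<le> 4" "q $$ (i, j) \<ge> 1"
    using bij_betwE[OF bij] by fastforce+
  let ?R = "{kl \<in> ?I. p $$ kl \<le> p $$ (i, j)}"
  have "(\<lambda>ij. q $$ ij) ` ?R = {1..q $$ (i, j)}"
  proof (intro equalityI subsetI)
    fix x assume "x \<in> (\<lambda>ij. q $$ ij) ` ?R"
    then obtain kl where kl: "kl \<in> ?I" "p $$ kl \<le> p $$ (i, j)" "x = q $$ kl" by auto
    then have "x \<le> q $$ (i, j)" using mono[OF ij kl(1)] by linarith
    moreover have "x \<ge> 1" using bij_betwE[OF bij] kl by fastforce
    ultimately show "x \<in> {1..q $$ (i, j)}" by simp
  next
    fix x assume x: "x \<in> {1..q $$ (i, j)}"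
    then have "x \<in> {1..4}" using le by auto
    then obtain kl where kl: "kl \<in> ?I" "x = q $$ kl"
      using bij_betw_imp_surj_on[OF bij] by blast
    then have "p $$ kl \<le> p $$ (i, j)" using x mono[OF ij kl(1)] by auto
    then show "x \<in> (\<lambda>ij. q $$ ij) ` ?R" using kl by blast
  qed
  moreover have "inj_on (\<lambda>ij. q $$ ij) ?R"
    using bij_betw_imp_inj_on[OF bij] by (rule inj_on_subset) auto
  ultimately have "card ?R = q $$ (i, j)"
    using card_image[of "\<lambda>ij. q $$ ij" ?R] by simp
  then show "q $$ (i, j) = reduction p $$ (i, j)"
    using ij by (auto simp: reduction_def)
qed


section \<open>Secant numbers\<close>

definition fps_sec :: "real fps" where
  "fps_sec = inverse (fps_cos 1)"

definition secant_number :: "nat \<Rightarrow> real" where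
  "secant_number m = fact (2 * m) * fps_nth fps_sec (2 * m)"

lemma sec_has_fps_expansion: "(\<lambda>x. 1 / cos x) has_fps_expansion fps_sec"
  unfolding fps_sec_def inverse_eq_divide[symmetric]
  by (intro has_fps_expansion_inverse has_fps_expansion_cos') simp

lemma fps_nth_sec:
  "fps_nth fps_sec k = (if even k then secant_number (k div 2) / fact k else 0)"
proof (cases "even k")
  case True
  then show ?thesis by (auto simp: secant_number_def elim!: evenE)
next
  case False
  have "fps_compose fps_sec (- fps_X) = inverse (fps_compose (fps_cos 1) (- fps_X))"
    unfolding fps_sec_def by (rule fps_inverse_compose) auto
  also have "fps_compose (fps_cos 1) (- fps_X) = (fps_cos 1 :: real fps)"
    by (rule fps_ext) (simp add: fps_compose_uminus' fps_cos_def)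
  finally have "fps_nth (fps_compose fps_sec (- fps_X)) k = fps_nth fps_sec k"
    by (simp add: fps_sec_def)
  with False show ?thesis by (simp add: fps_compose_uminus')
qed

lemma fps_sec_eq:
  "fps_sec = Abs_fps (\<lambda>k. if even k then secant_number (k div 2) / fact k else 0)"
  by (rule fps_ext) (simp add: fps_nth_sec)

end

theory Submission
  imports Defs "HOL-Combinatorics.Multiset_Permutations"
begin

text \<open>
  Among the six relative orders of two columns whose lower entry is the smaller one, only the
  order in which the whole second column lies below the first is excluded. Hence the support
  condition says that reading a puzzle column by column, each column from top to bottom, gives a
  permutation with pattern \<open>x\<^sub>0 > x\<^sub>1 < x\<^sub>2 > x\<^sub>3 < \<dots>\<close>.

  Such permutations are counted as in Andre's theorem. Consider the permutations of a set
  of size \<open>2m > 0\<close> whose first \<open>2k\<close> entries decrease and whose remaining entries alternate. For each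
  of them exactly one of \<open>k - 1\<close> and \<open>k + 1\<close> has the same property, according to the comparison at
  the seam; so their numbers have alternating sum \<open>0\<close> over \<open>k\<close>. Choosing the set of the first
  \<open>2k\<close> entries turns this into the recurrence that \<open>sec \<cdot> cos = 1\<close> gives for the secant numbers.
\<close>

section \<open>Alternating permutations\<close>

definition alternating :: "'a::linorder list \<Rightarrow> bool" where
  "alternating xs \<longleftrightarrow>
     (\<forall>i. Suc i < length xs \<longrightarrow> (if even i then xs ! Suc i < xs ! i else xs ! i < xs ! Suc i))"

definition alternating_perms :: "'a::linorder set \<Rightarrow> 'a list set" where
  "alternating_perms A = {xs \<in> permutations_of_set A. alternating xs}"

text \<open>The last entry of the prefix and the first entry after it are deliberately not compared:
  this free seam lets one list qualify for two neighbouring values of \<open>k\<close>. The bound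
  \<open>2 * k\<close> on the prefix keeps \<open>take\<close> from truncating silently.\<close>

definition decreasing_then_alternating :: "nat \<Rightarrow> 'a::linorder list \<Rightarrow> bool" where
  "decreasing_then_alternating k xs \<longleftrightarrow>
     2 * k \<le> length xs \<and> sorted_wrt (>) (take (2 * k) xs) \<and> alternating (drop (2 * k) xs)"

lemma alternating_Nil [simp]: "alternating []"
  by (simp add: alternating_def)

text \<open>Removing two entries preserves the parity of positions, so the rest is again
  alternating.\<close>

lemma alternating_Cons_Cons:
  "alternating (a # b # xs) \<longleftrightarrow> b < a \<and> (xs \<noteq> [] \<longrightarrow> b < hd xs) \<and> alternating xs"
proof -
  have split: "(\<forall>i. Q i) \<longleftrightarrow> Q 0 \<and> Q (Suc 0) \<and> (\<forall>i. Q (Suc (Suc i)))" for Q :: "nat \<Rightarrow> bool"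
  proof (intro iffI allI)
    show "Q i" if "Q 0 \<and> Q (Suc 0) \<and> (\<forall>i. Q (Suc (Suc i)))" for i
      using that by (induction i rule: induct_nat_012) auto
  qed auto
  show ?thesis
    unfolding alternating_def by (subst split) (cases xs; simp)
qed

text \<open>Let \<open>u\<close> end the prefix and \<open>a, b\<close> begin the rest. If
  \<open>u > a\<close>, the descent \<open>a > b\<close> can join the prefix; if
  \<open>u < a\<close>, the last two prefix entries can join the rest. Distinctness leaves exactly
  one option. An empty prefix can only grow and an empty rest can only give way.\<close>

lemma decreasing_then_alternating_seam:
  assumes xs: "decreasing_then_alternating k xs" "distinct xs" "even (length xs)" "xs \<noteq> []"
  shows "decreasing_then_alternating (Suc k) xs \<longleftrightarrow>
    \<not> (k > 0 \<and> decreasing_then_alternating (k - 1) xs)"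
proof -
  define us vs where "us = take (2 * k) xs" and "vs = drop (2 * k) xs"
  have xs_eq: "xs = us @ vs" and len: "length us = 2 * k"
    using xs(1) by (simp_all add: us_def vs_def decreasing_then_alternating_def)
  have us: "sorted_wrt (>) us" and vs: "alternating vs"
    using xs(1) by (simp_all add: us_def vs_def decreasing_then_alternating_def)
  have even_vs: "even (length vs)"
    using xs(3) len by (simp add: xs_eq)
  \<comment> \<open>Even length rules out a single remaining entry, so entries always move across
    the seam in pairs.\<close>
  have vs_cases: "vs = [] \<or> (\<exists>a b r. vs = a # b # r)"
    using even_vs by (cases vs rule: remdups_adj.cases) auto
  have us_cases: "k > 0 \<Longrightarrow> \<exists>ws c d. us = ws @ [c, d] \<and> length ws = 2 * (k - 1)"
  proof -
    assume "k > 0"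
    then obtain l where k: "k = Suc l" by (cases k) auto
    have "us = take (2 * l) us @ drop (2 * l) us" by simp
    moreover have "length (drop (2 * l) us) = Suc (Suc 0)" using len k by simp
    then obtain c d where "drop (2 * l) us = [c, d]"
      unfolding length_Suc_conv length_0_conv by blast
    ultimately have "us = take (2 * l) us @ [c, d]" by simp
    moreover have "length (take (2 * l) us) = 2 * (k - 1)" using len k by simp
    ultimately show ?thesis by blast
  qed
  \<comment> \<open>Since \<open>b < a\<close> is known, only \<open>a\<close> must be tested
    against the prefix, and the last entry is the smallest there.\<close>
  have next_iff: "decreasing_then_alternating (Suc k) xs \<longleftrightarrow> us = [] \<or> last us > hd vs"
    if v: "vs = a # b # r" for a b r
  proof -
    have "decreasing_then_alternating (Suc k) xs \<longleftrightarrow> sorted_wrt (>) (us @ [a, b])"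
      using vs by (simp add: decreasing_then_alternating_def xs_eq len v alternating_Cons_Cons)
    also have "\<dots> \<longleftrightarrow> (\<forall>x\<in>set us. a < x)"
      using us vs by (auto simp: sorted_wrt_append v alternating_Cons_Cons)
    also have "\<dots> \<longleftrightarrow> us = [] \<or> last us > a"
      using us by (cases us rule: rev_cases) (auto simp: sorted_wrt_append)
    finally show ?thesis using v by simp
  qed
  have prev_iff: "decreasing_then_alternating (k - 1) xs \<longleftrightarrow> vs = [] \<or> last us < hd vs"
    if k: "k > 0"
  proof -
    obtain ws c d where w: "us = ws @ [c, d]" "length ws = 2 * (k - 1)"
      using us_cases k by blast
    show ?thesis
      using us vs
      by (auto simp: decreasing_then_alternating_def xs_eq w alternating_Cons_Cons
          sorted_wrt_append)
  qed
  show ?thesis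
  proof (cases "vs = []")
    case True
    then have "k > 0" using len xs(4) by (cases k) (auto simp: xs_eq)
    then show ?thesis
      using True len prev_iff by (auto simp: decreasing_then_alternating_def xs_eq)
  next
    case False
    then obtain a b r where v: "vs = a # b # r" using vs_cases by blast
    have "last us \<noteq> a" if "us \<noteq> []"
      using xs(2) that last_in_set[OF that] by (auto simp: xs_eq v)
    then show ?thesis
      using next_iff[OF v] prev_iff len v by (cases "k > 0") auto
  qed
qed

text \<open>The decreasing prefix is determined by its set \<open>B\<close>; as the seam is free,
  any alternating arrangement of \<open>A - B\<close> may follow.\<close>

lemma card_decreasing_then_alternating:
  fixes A :: "'a::linorder set"
  assumes fin: "finite A"
  shows "card {xs \<in> permutations_of_set A. decreasing_then_alternating k xs} =
    (\<Sum>B | B \<subseteq> A \<and> card B = 2 * k. card (alternating_perms (A - B)))"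
proof -
  let ?S = "SIGMA B:{B. B \<subseteq> A \<and> card B = 2 * k}. alternating_perms (A - B)"
  let ?f = "\<lambda>(B, zs). rev (sorted_list_of_set B) @ zs"
  let ?g = "\<lambda>xs. (set (take (2 * k) xs), drop (2 * k) xs)"
  have "bij_betw ?f ?S {xs \<in> permutations_of_set A. decreasing_then_alternating k xs}"
  proof (rule bij_betw_byWitness[where f' = ?g])
    show "\<forall>x\<in>?S. ?g (?f x) = x"
    proof
      fix x assume "x \<in> ?S"
      then obtain B zs where x: "x = (B, zs)" "B \<subseteq> A" "card B = 2 * k" by blast
      then have "finite B" using fin finite_subset by blast
      then show "?g (?f x) = x" using x by simp
    qed
    show "\<forall>xs\<in>{xs \<in> permutations_of_set A. decreasing_then_alternating k xs}. ?f (?g xs) = xs"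
    proof
      fix xs assume "xs \<in> {xs \<in> permutations_of_set A. decreasing_then_alternating k xs}"
      then have xs: "xs \<in> permutations_of_set A" "decreasing_then_alternating k xs" by auto
      let ?t = "take (2 * k) xs"
      have "sorted_wrt (<) (rev ?t)"
        using xs by (simp add: decreasing_then_alternating_def sorted_wrt_rev)
      then have "sorted (rev ?t)" "distinct (rev ?t)"
        by (simp_all only: strict_sorted_iff)
      then have "sorted_list_of_set (set ?t) = rev ?t"
        by (metis set_rev sorted_list_of_set.idem_if_sorted_distinct)
      then show "?f (?g xs) = xs" by simp
    qed
    show "?f ` ?S \<subseteq> {xs \<in> permutations_of_set A. decreasing_then_alternating k xs}"
    proof (rule image_subsetI)
      fix x assume "x \<in> ?S"
      then obtain B zs where x: "x = (B, zs)" and B: "B \<subseteq> A" "card B = 2 * k"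
        and zs: "zs \<in> alternating_perms (A - B)" by blast
      have "finite B" using B fin finite_subset by blast
      then show "?f x \<in> {xs \<in> permutations_of_set A. decreasing_then_alternating k xs}"
        using B zs strict_sorted_list_of_set[of B]
        by (auto simp: x permutations_of_set_def alternating_perms_def
            decreasing_then_alternating_def sorted_wrt_rev)
    qed
    show "?g ` {xs \<in> permutations_of_set A. decreasing_then_alternating k xs} \<subseteq> ?S"
    proof (rule image_subsetI)
      fix xs assume "xs \<in> {xs \<in> permutations_of_set A. decreasing_then_alternating k xs}"
      then have xs: "xs \<in> permutations_of_set A" "decreasing_then_alternating k xs" by auto
      let ?t = "take (2 * k) xs" and ?d = "drop (2 * k) xs"
      have d: "distinct (?t @ ?d)" "set (?t @ ?d) = A"
        using xs by (auto simp: permutations_of_set_def simp del: set_append)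
      have "set ?t \<subseteq> A" using d(2) by (auto dest: in_set_takeD)
      moreover have "card (set ?t) = 2 * k"
        using d xs(2) by (simp add: distinct_card decreasing_then_alternating_def)
      moreover have "set ?d = A - set ?t"
        using d unfolding distinct_append set_append by blast
      then have "?d \<in> alternating_perms (A - set ?t)"
        using d xs(2) unfolding alternating_perms_def permutations_of_set_def
          decreasing_then_alternating_def by simp
      ultimately show "?g xs \<in> ?S" by blast
    qed
  qed
  then have "card {xs \<in> permutations_of_set A. decreasing_then_alternating k xs} = card ?S"
    by (rule bij_betw_same_card[symmetric])
  also have "\<dots> = (\<Sum>B | B \<subseteq> A \<and> card B = 2 * k. card (alternating_perms (A - B)))"
    by (rule card_SigmaI) (use fin in \<open>auto simp: alternating_perms_def\<close>)
  finally show ?thesis .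
qed

lemma sum_decreasing_then_alternating:
  fixes A :: "'a::linorder set"
  assumes fin: "finite A" and card: "card A = 2 * m" and "m > 0"
  shows "(\<Sum>k\<le>m. (-1) ^ k *
    real (card {xs \<in> permutations_of_set A. decreasing_then_alternating k xs})) = 0"
proof -
  let ?D = decreasing_then_alternating
  define P where "P k = {xs \<in> permutations_of_set A. ?D k xs}" for k
  define X where "X k = (if k = 0 then {} else P (k - 1) \<inter> P k)" for k
  have finP: "finite (P k)" for k by (simp add: P_def)
  have perm: "distinct xs" "length xs = 2 * m" "xs \<noteq> []" if "xs \<in> permutations_of_set A" for xs
    using that card \<open>m > 0\<close> length_finite_permutations_of_set[OF that]
    by (auto simp: permutations_of_set_def)
  have seam: "xs \<in> P (Suc k) \<longleftrightarrow> \<not> (k > 0 \<and> xs \<in> P (k - 1))" if "xs \<in> P k" for xs k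
    using that decreasing_then_alternating_seam[of k xs] perm[of xs] by (auto simp: P_def)
  have "P k = X k \<union> X (Suc k)" "X k \<inter> X (Suc k) = {}" for k
    using seam[of _ k] by (auto simp: X_def)
  then have "card (P k) = card (X k) + card (X (Suc k))" for k
    by (metis card_Un_disjoint finP finite_Un)
  then have "(\<Sum>k\<le>m. (-1) ^ k * real (card (P k))) =
      (\<Sum>k\<le>m. (-1) ^ k * real (card (X k)) - (-1) ^ Suc k * real (card (X (Suc k))))"
    by (simp add: algebra_simps)
  also have "\<dots> = card (X 0) - (-1) ^ Suc m * real (card (X (Suc m)))"
    by (subst sum_telescope) simp
  \<comment> \<open>A prefix of length \<open>2 * m + 2\<close> would exceed the list.\<close>
  also have "P (Suc m) = {}"
    using perm by (fastforce simp: P_def decreasing_then_alternating_def)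
  then have "card (X 0) - (-1) ^ Suc m * real (card (X (Suc m))) = 0"
    by (simp add: X_def)
  finally show ?thesis by (simp add: P_def)
qed

section \<open>The secant recurrence from sec * cos = 1\<close>

lemma secant_number_0: "secant_number 0 = 1"
  by (simp add: secant_number_def fps_sec_def fps_cos_def)

text \<open>This compares coefficients at \<open>2 * m\<close> in sec * cos = 1 and scales by
  \<open>fact (2 * m)\<close>, which turns the reciprocal factorials into binomials.\<close>

lemma secant_number_recurrence:
  assumes "m > 0"
  shows "(\<Sum>k\<le>m. (-1) ^ k * real ((2 * m) choose (2 * k)) * secant_number (m - k)) = 0"
proof -
  have "fps_cos 1 * fps_sec = 1"
    unfolding fps_sec_def by (rule inverse_mult_eq_1') (simp add: fps_cos_def)
  then have "0 = fps_nth (fps_cos 1 * fps_sec) (2 * m)"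
    using assms by simp
  also have "\<dots> = (\<Sum>i\<in>{0..2 * m}. fps_nth (fps_cos 1) i * fps_nth fps_sec (2 * m - i))"
    by (rule fps_mult_nth)
  \<comment> \<open>Odd coefficients of cos vanish.\<close>
  also have "\<dots> = (\<Sum>i\<in>(\<lambda>k. 2 * k) ` {..m}. fps_nth (fps_cos 1) i * fps_nth fps_sec (2 * m - i))"
  proof (rule sum.mono_neutral_right)
    show "\<forall>i\<in>{0..2 * m} - (\<lambda>k. 2 * k) ` {..m}. fps_nth (fps_cos 1) i * fps_nth fps_sec (2 * m - i) = 0"
      by (auto simp: fps_cos_def elim!: evenE)
  qed auto
  also have "\<dots> = (\<Sum>k\<le>m. (-1) ^ k / fact (2 * k) * (secant_number (m - k) / fact (2 * m - 2 * k)))"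
    by (subst sum.reindex) (auto simp: inj_on_def fps_cos_def fps_nth_sec intro!: sum.cong
        simp flip: diff_mult_distrib2)
  finally have "0 = fact (2 * m) *
    (\<Sum>k\<le>m. (-1) ^ k / fact (2 * k) * (secant_number (m - k) / fact (2 * m - 2 * k)))" by simp
  also have "\<dots> = (\<Sum>k\<le>m. (-1) ^ k * real ((2 * m) choose (2 * k)) * secant_number (m - k))"
    unfolding sum_distrib_left
    by (rule sum.cong) (auto simp: binomial_fact)
  finally show ?thesis by simp
qed

text \<open>Both sides satisfy the same recurrence, whose term at \<open>k = 0\<close> is the
  unknown value. The set \<open>A\<close> stays arbitrary because the induction hypothesis is
  applied to the complements \<open>A - B\<close>.\<close>

theorem card_alternating_perms:
  fixes A :: "'a::linorder set"
  assumes "finite A" "card A = 2 * m"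
  shows "real (card (alternating_perms A)) = secant_number m"
  using assms
proof (induction m arbitrary: A rule: less_induct)
  case (less m)
  show ?case
  proof (cases "m = 0")
    case True
    then have "alternating_perms A = {[]}"
      using less.prems by (auto simp: alternating_perms_def)
    then show ?thesis using True by (simp add: secant_number_0)
  next
    case False
    let ?c = "\<lambda>k. real (card {xs \<in> permutations_of_set A. decreasing_then_alternating k xs})"
    let ?s = "\<lambda>k. real ((2 * m) choose (2 * k)) * secant_number (m - k)"
    have c: "?c k = ?s k" if k: "k \<in> {1..m}" for k
    proof -
      have "?c k = (\<Sum>B | B \<subseteq> A \<and> card B = 2 * k. real (card (alternating_perms (A - B))))"
        using less.prems by (simp add: card_decreasing_then_alternating)
      also have "\<dots> = (\<Sum>B | B \<subseteq> A \<and> card B = 2 * k. secant_number (m - k))"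
      proof (rule sum.cong)
        fix B assume "B \<in> {B. B \<subseteq> A \<and> card B = 2 * k}"
        then have "card (A - B) = 2 * (m - k)"
          using less.prems finite_subset[of B A] by (simp add: card_Diff_subset)
        then show "real (card (alternating_perms (A - B))) = secant_number (m - k)"
          using less.IH[of "m - k" "A - B"] less.prems k by simp
      qed simp
      finally show ?thesis using less.prems by (simp add: n_subsets)
    qed
    have c0: "?c 0 = real (card (alternating_perms A))"
      by (simp add: decreasing_then_alternating_def alternating_perms_def)
    have "(\<Sum>k\<le>m. (-1) ^ k * ?c k) = (\<Sum>k\<le>m. (-1) ^ k * ?s k)"
      using sum_decreasing_then_alternating[of A m] secant_number_recurrence[of m] less.prems False
      by (simp add: mult.assoc)
    moreover have "{..m} = insert 0 {1..m}" by auto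
    ultimately have "?c 0 + (\<Sum>k=1..m. (-1) ^ k * ?c k) = ?s 0 + (\<Sum>k=1..m. (-1) ^ k * ?s k)"
      by simp
    moreover have "(\<Sum>k=1..m. (-1) ^ k * ?c k) = (\<Sum>k=1..m. (-1) ^ k * ?s k)"
      by (intro sum.cong) (use c in auto)
    ultimately have "?c 0 = ?s 0" by linarith
    then show ?thesis using c0 by simp
  qed
qed

section \<open>Puzzles as alternating permutations\<close>

text \<open>Write \<open>a b\<close> for the top row and \<open>c d\<close> for the bottom row.
  Given \<open>c < a\<close> and \<open>d < b\<close>, failure of \<open>c < b\<close> forces
  \<open>d < b < c < a\<close>, the one excluded order.\<close>

lemma reduction_mem_iff:
  assumes "inj_on (\<lambda>ij. p $$ ij) ({0..<2} \<times> {0..<2})"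
  shows "reduction p \<in> {A1, A2, A3, A4, A5} \<longleftrightarrow>
    p $$ (1, 0) < p $$ (0, 0) \<and> p $$ (1, 1) < p $$ (0, 1) \<and> p $$ (1, 0) < p $$ (0, 1)"
proof -
  have I: "{0..<2::nat} \<times> {0..<2::nat} = {(0, 0), (0, 1), (1, 0), (1, 1)}"
    by (auto simp: numeral_2_eq_2 less_Suc_eq)
  have r: "reduction p $$ (i, j) = (\<Sum>kl\<in>{0..<2} \<times> {0..<2}. of_bool (p $$ kl \<le> p $$ (i, j)))"
    if "i < 2" "j < 2" for i j
    using that by (simp add: reduction_def sum_of_bool_eq Int_def)
  have eq_iff: "reduction p = q \<longleftrightarrow> reduction p $$ (0, 0) = q $$ (0, 0) \<and>
      reduction p $$ (0, 1) = q $$ (0, 1) \<and> reduction p $$ (1, 0) = q $$ (1, 0) \<and>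
      reduction p $$ (1, 1) = q $$ (1, 1)"
    if "q \<in> carrier_mat 2 2" for q
    using that by (auto simp: reduction_def less_2_cases_iff intro!: eq_matI)
  have carrier: "A1 \<in> carrier_mat 2 2" "A2 \<in> carrier_mat 2 2" "A3 \<in> carrier_mat 2 2"
    "A4 \<in> carrier_mat 2 2" "A5 \<in> carrier_mat 2 2"
    by (auto simp: A1_def A2_def A3_def A4_def A5_def mat_of_rows_list_def)
  define a b c d where abcd: "a = p $$ (0, 0)" "b = p $$ (0, 1)" "c = p $$ (1, 0)" "d = p $$ (1, 1)"
  \<comment> \<open>The summand 1 counts the entry itself. Once the six comparisons are decided,
    every rank is a numeral.\<close>
  have rank: "reduction p $$ (0, 0) = 1 + of_bool (b \<le> a) + of_bool (c \<le> a) + of_bool (d \<le> a)"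
    "reduction p $$ (0, 1) = 1 + of_bool (a \<le> b) + of_bool (c \<le> b) + of_bool (d \<le> b)"
    "reduction p $$ (1, 0) = 1 + of_bool (a \<le> c) + of_bool (b \<le> c) + of_bool (d \<le> c)"
    "reduction p $$ (1, 1) = 1 + of_bool (a \<le> d) + of_bool (b \<le> d) + of_bool (c \<le> d)"
    by (simp_all add: r I abcd del: sum_of_bool_eq)
  have "a \<noteq> b" "a \<noteq> c" "a \<noteq> d" "b \<noteq> c" "b \<noteq> d" "c \<noteq> d"
    using assms unfolding I abcd by (auto simp: inj_on_def)
  then have "reduction p \<in> {A1, A2, A3, A4, A5} \<longleftrightarrow> c < a \<and> d < b \<and> c < b"
    unfolding insert_iff empty_iff eq_iff[OF carrier(1)] eq_iff[OF carrier(2)]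
      eq_iff[OF carrier(3)] eq_iff[OF carrier(4)] eq_iff[OF carrier(5)] rank
    by (elim linorder_neqE)
      (simp_all add: A1_def A2_def A3_def A4_def A5_def mat_of_rows_list_def)
  then show ?thesis by (simp add: abcd)
qed

section \<open>Column reading of a puzzle\<close>

definition puzzle_word :: "nat \<Rightarrow> nat mat \<Rightarrow> nat list" where
  "puzzle_word n M = map (\<lambda>i. M $$ (i mod 2, i div 2)) [0..<2 * n + 2]"

definition word_puzzle :: "nat \<Rightarrow> nat list \<Rightarrow> nat mat" where
  "word_puzzle n xs = Matrix.mat 2 (n + 1) (\<lambda>(i, j). xs ! (2 * j + i))"

lemma length_puzzle_word [simp]: "length (puzzle_word n M) = 2 * n + 2"
  by (simp add: puzzle_word_def)

lemma nth_puzzle_word [simp]: "i < 2 * n + 2 \<Longrightarrow> puzzle_word n M ! i = M $$ (i mod 2, i div 2)"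
  by (simp add: puzzle_word_def del: upt_Suc)

lemma bij_betw_column_order:
  "bij_betw (\<lambda>i. (i mod 2, i div 2)) {0..<2 * n + 2} ({0..<2} \<times> {0..<n + 1::nat})"
  by (rule bij_betw_byWitness[where f' = "\<lambda>(i, j). 2 * j + i"]) auto

lemma standard_puzzle_iff:
  "standard_puzzle n M \<longleftrightarrow>
    M \<in> carrier_mat 2 (n + 1) \<and> puzzle_word n M \<in> permutations_of_set {1..2 * n + 2}"
proof -
  have "bij_betw (\<lambda>ij. M $$ ij) ({0..<2} \<times> {0..<n + 1}) {1..2 * n + 2} \<longleftrightarrow>
      bij_betw (\<lambda>i. M $$ (i mod 2, i div 2)) {0..<2 * n + 2} {1..2 * n + 2}"
    using bij_betw_comp_iff[OF bij_betw_column_order[of n], of "\<lambda>ij. M $$ ij"]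
    by (simp add: comp_def)
  also have "\<dots> \<longleftrightarrow> puzzle_word n M \<in> permutations_of_set {1..2 * n + 2}"
    unfolding bij_betw_def puzzle_word_def permutations_of_set_def
    by (auto simp: distinct_map simp del: upt_Suc)
  finally show ?thesis by (simp add: standard_puzzle_def)
qed

text \<open>Top entries occupy the even positions. Steps from even positions stay inside a column,
  and steps from odd positions lead to the top of the next column.\<close>

lemma alternating_puzzle_word_iff:
  "alternating (puzzle_word n M) \<longleftrightarrow>
    (\<forall>j\<le>n. M $$ (1, j) < M $$ (0, j)) \<and> (\<forall>j<n. M $$ (1, j) < M $$ (0, Suc j))"
proof -
  have split: "(\<forall>i. Q i) \<longleftrightarrow> (\<forall>j. Q (2 * j)) \<and> (\<forall>j. Q (Suc (2 * j)))" for Q :: "nat \<Rightarrow> bool"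
    by (metis even_two_times_div_two odd_two_times_div_two_succ Suc_eq_plus1)
  show ?thesis
    unfolding alternating_def by (subst split) (auto simp: less_Suc_eq_le)
qed

lemma is_support_iff_alternating:
  assumes M: "standard_puzzle n M" and "n \<ge> 1"
  shows "is_support {A1, A2, A3, A4, A5} n M \<longleftrightarrow> alternating (puzzle_word n M)"
proof -
  let ?C = "\<lambda>j. M $$ (1, j) < M $$ (0, j)"
  have inj: "inj_on (\<lambda>ij. M $$ ij) ({0..<2} \<times> {0..<n + 1})"
    using M by (simp add: standard_puzzle_def bij_betw_def)
  have "reduction (piece M j) \<in> {A1, A2, A3, A4, A5} \<longleftrightarrow>
      ?C j \<and> ?C (Suc j) \<and> M $$ (1, j) < M $$ (0, Suc j)" if "j < n" for j
  proof -
    have "inj_on (\<lambda>ij. piece M j $$ ij) ({0..<2} \<times> {0..<2})"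
    proof (rule inj_onI)
      fix x y assume xy: "x \<in> {0..<2} \<times> {0..<2}" "y \<in> {0..<2} \<times> {0..<2}"
        and "piece M j $$ x = piece M j $$ y"
      then have "M $$ (fst x, j + snd x) = M $$ (fst y, j + snd y)"
        by (auto simp: piece_def)
      then have "(fst x, j + snd x) = (fst y, j + snd y)"
        by (rule inj_onD[OF inj]) (use xy \<open>j < n\<close> in auto)
      then show "x = y" by (simp add: prod_eq_iff)
    qed
    from reduction_mem_iff[OF this] show ?thesis by (simp add: piece_def)
  qed
  then have "is_support {A1, A2, A3, A4, A5} n M \<longleftrightarrow>
      (\<forall>j<n. ?C j \<and> ?C (Suc j) \<and> M $$ (1, j) < M $$ (0, Suc j))"
    by (simp add: is_support_def)
  also have "\<dots> \<longleftrightarrow> (\<forall>j\<le>n. ?C j) \<and> (\<forall>j<n. M $$ (1, j) < M $$ (0, Suc j))"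
  proof -
    have "(\<forall>j<n. ?C j \<and> ?C (Suc j)) \<longleftrightarrow> (\<forall>j\<le>n. ?C j)"
    proof (intro iffI allI impI)
      \<comment> \<open>Column 0 is the left column of the first piece, which exists as
        \<open>n\<close> is positive; column \<open>Suc i\<close> is the right column of piece
        \<open>i\<close>.\<close>
      show "?C j" if "\<forall>j<n. ?C j \<and> ?C (Suc j)" "j \<le> n" for j
        using that \<open>n \<ge> 1\<close> by (cases j) auto
    qed auto
    then show ?thesis by blast
  qed
  finally show ?thesis by (simp only: alternating_puzzle_word_iff)
qed

lemma puzzle_word_word_puzzle:
  "length xs = 2 * n + 2 \<Longrightarrow> puzzle_word n (word_puzzle n xs) = xs"
  by (rule nth_equalityI) (auto simp: word_puzzle_def)

lemma word_puzzle_puzzle_word: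
  "M \<in> carrier_mat 2 (n + 1) \<Longrightarrow> word_puzzle n (puzzle_word n M) = M"
  by (rule eq_matI) (auto simp: word_puzzle_def)

lemma bij_betw_puzzle_word:
  assumes "n \<ge> 1"
  shows "bij_betw (puzzle_word n) (puzzles n {A1, A2, A3, A4, A5}) (alternating_perms {1..2 * n + 2})"
proof -
  have "M \<in> puzzles n {A1, A2, A3, A4, A5} \<longleftrightarrow>
      M \<in> carrier_mat 2 (n + 1) \<and> puzzle_word n M \<in> alternating_perms {1..2 * n + 2}" for M
    using is_support_iff_alternating[OF _ assms, of M]
    unfolding puzzles_def alternating_perms_def mem_Collect_eq standard_puzzle_iff by blast
  \<comment> \<open>The word records entries but not dimensions, so the carrier condition is kept to
    make \<open>word_puzzle\<close> an inverse.\<close>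
  then have puzzles: "puzzles n {A1, A2, A3, A4, A5} =
      {M \<in> carrier_mat 2 (n + 1). puzzle_word n M \<in> alternating_perms {1..2 * n + 2}}"
    by blast
  have len: "length xs = 2 * n + 2" if "xs \<in> alternating_perms {1..2 * n + 2}" for xs
    using that length_finite_permutations_of_set[of xs "{1..2 * n + 2}"]
    by (simp add: alternating_perms_def)
  have inv: "puzzle_word n (word_puzzle n xs) = xs" if "xs \<in> alternating_perms {1..2 * n + 2}" for xs
    by (rule puzzle_word_word_puzzle[OF len[OF that]])
  have carrier: "word_puzzle n xs \<in> carrier_mat 2 (n + 1)" for xs
    by (simp add: word_puzzle_def)
  show ?thesis
    unfolding puzzles
  proof (rule bij_betw_byWitness[where f' = "word_puzzle n"])
    show "word_puzzle n ` alternating_perms {1..2 * n + 2} \<subseteq>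
      {M \<in> carrier_mat 2 (n + 1). puzzle_word n M \<in> alternating_perms {1..2 * n + 2}}"
      using inv carrier by (intro image_subsetI CollectI conjI) simp_all
  qed (use inv word_puzzle_puzzle_word in blast)+
qed

theorem theorem3p1:
  fixes n :: nat
  assumes "n \<ge> 1"
  shows "real (num_puzzles n {A1, A2, A3, A4, A5}) = secant_number (n + 1)"
proof -
  have "num_puzzles n {A1, A2, A3, A4, A5} = card (alternating_perms {1..2 * n + 2})"
    unfolding num_puzzles_def by (rule bij_betw_same_card[OF bij_betw_puzzle_word[OF assms]])
  moreover have "card {1..2 * n + 2} = 2 * (n + 1)" by simp
  ultimately show ?thesis
    using card_alternating_perms[of "{1..2 * n + 2}" "n + 1"] by (simp only: finite_atLeastAtMost)
qed

end
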